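(* Let $e\geq2$ and $k\in\{1,\dots,e-1\}$. The eigenvalues of the real symmetric matrix $A_{e,k}$ are the following: - $k\binom{e-1}{k}$, with multiplicity $1$; - $0$, with multiplicity $\binom ek-e$; - $-\binom{e-2}{k-1}$, with multiplicity $e-1$. Moreover, the constant vector $\mathbf{1}$ (all of whose entries are $1$) is an eigenvector of $A_{e,k}$ for the eigenvalue $k\binom{e-1}{k}$.
   Context: $\mathcal{P}_{e,k}$ is the set of subsets of $\{1,\dots,e\}$ of cardinality $k$, and $A_{e,k}=(a_{E,F})_{E,F\in\mathcal{P}_{e,k}}$ is the real symmetric matrix of size $\binom ek$ with $a_{E,F}:=k-|E\cap F|$. A multiplicity equal to $0$ means that the value is not an eigenvalue. *)

theory Defs
  imports "Jordan_Normal_Form.Char_Poly"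
begin

definition k_subsets :: "nat \<Rightarrow> nat \<Rightarrow> nat set set" where
  "k_subsets e k = {E. E \<subseteq> {1..e} \<and> card E = k}"

text \<open>
  Matrices of type \<^typ>\<open>'a mat\<close> are indexed by initial segments of the natural
  numbers, so the rows and columns are labelled through an enumeration \<open>\<phi>\<close> of the
  \<open>k\<close>-subsets. Changing \<open>\<phi>\<close> conjugates the matrix by a permutation matrix; results are
  stated for every \<open>\<phi>\<close> with \<open>k_subsets_enum e k \<phi>\<close>.
\<close>

definition k_subsets_enum :: "nat \<Rightarrow> nat \<Rightarrow> (nat \<Rightarrow> nat set) \<Rightarrow> bool" where
  "k_subsets_enum e k \<phi> \<longleftrightarrow> bij_betw \<phi> {0..<e choose k} (k_subsets e k)"

definition A_mat :: "nat \<Rightarrow> nat \<Rightarrow> (nat \<Rightarrow> nat set) \<Rightarrow> real mat" where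
  "A_mat e k \<phi> = mat (e choose k) (e choose k)
     (\<lambda>(i, j). real k - real (card (\<phi> i \<inter> \<phi> j)))"

lemma k_subsets_enum_exists: "\<exists>\<phi>. k_subsets_enum e k \<phi>"
proof -
  have "finite (k_subsets e k)"
    unfolding k_subsets_def by (rule finite_subset[of _ "Pow {1..e}"]) auto
  moreover have "card (k_subsets e k) = e choose k"
    unfolding k_subsets_def using n_subsets[of "{1..e}" k] by simp
  ultimately show ?thesis
    unfolding k_subsets_enum_def using ex_bij_betw_nat_finite[of "k_subsets e k"] by simp
qed

end

theory Submission
  imports Defs
begin

text \<open>
  The entry of the matrix at \<open>(E, F)\<close> is \<open>k - |E \<inter> F| = |E - F|\<close>, the number of points that
  lie in \<open>E\<close> but not in \<open>F\<close>. Counting these points one at a time writes the matrix as a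
  product \<open>M * C\<close>, where \<open>M\<close> is the incidence matrix between \<open>k\<close>-subsets and points, and \<open>C\<close>
  records non-incidence between points and \<open>k\<close>-subsets (\<open>A_mat_factorization\<close>).

  The product in the other order has size only \<open>e\<close>. Its entry at the points \<open>(p, q)\<close> counts
  the \<open>k\<close>-subsets that avoid \<open>p\<close> and contain \<open>q\<close>. That number is \<open>0\<close> for \<open>p = q\<close> and
  \<open>s = binomial(e - 2, k - 1)\<close> otherwise, so \<open>C * M = s (J - I)\<close> with \<open>J\<close> the all-ones matrix
  (\<open>co_incidence_mult_incidence\<close>). Its characteristic polynomial is
  \<open>(x + s)^(e - 1) (x - (e - 1) s)\<close>, and \<open>(e - 1) s = k binomial(e - 1, k)\<close> by absorption.

  The characteristic polynomials of \<open>M * C\<close> and \<open>C * M\<close> agree up to a power of \<open>x\<close>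
  (\<open>char_poly_mult_swap\<close>), which yields all three multiplicities. The constant vector
  is an eigenvector since \<open>C\<close> and \<open>M\<close> both have constant row sums,
  \<open>binomial(e - 1, k)\<close> and \<open>k\<close>.
\<close>

section \<open>Characteristic polynomials of the two products of a pair of matrices\<close>

text \<open>
  Both sides equal \<open>d ^ m\<close> times the determinant of the block matrix with rows \<open>(d I, X)\<close> and
  \<open>(Y, I)\<close>: a column operation clears \<open>Y\<close> and leaves the Schur complement
  \<open>d I - X Y\<close>, and a row operation that first scales the lower rows by \<open>d\<close> clears \<open>Y\<close> and
  leaves \<open>d I - Y X\<close>. No division by \<open>d\<close> takes place, so the identity can be used over a
  polynomial ring with \<open>d\<close> any monic linear polynomial.
\<close>

lemma det_scalar_minus_mult_swap:
  fixes X Y :: "'a :: idom mat"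
  assumes X: "X \<in> carrier_mat n m" and Y: "Y \<in> carrier_mat m n"
  shows "d ^ m * det (d \<cdot>\<^sub>m 1\<^sub>m n - X * Y) = d ^ n * det (d \<cdot>\<^sub>m 1\<^sub>m m - Y * X)"
proof -
  let ?M = "four_block_mat (d \<cdot>\<^sub>m 1\<^sub>m n) X Y (1\<^sub>m m)"
  let ?R = "four_block_mat (1\<^sub>m n) (0\<^sub>m n m) (- Y) (1\<^sub>m m)"
  let ?L = "four_block_mat (1\<^sub>m n) (0\<^sub>m n m) (- Y) (d \<cdot>\<^sub>m 1\<^sub>m m)"
  have M: "?M \<in> carrier_mat (n + m) (n + m)" using X Y by auto
  have XY: "d \<cdot>\<^sub>m 1\<^sub>m n - X * Y \<in> carrier_mat n n"
    and YX: "d \<cdot>\<^sub>m 1\<^sub>m m - Y * X \<in> carrier_mat m m"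
    using X Y by (auto intro!: minus_carrier_mat mult_carrier_mat)
  have "?M * ?R = four_block_mat (d \<cdot>\<^sub>m 1\<^sub>m n - X * Y) X (0\<^sub>m m n) (1\<^sub>m m)"
    by (subst mult_four_block_mat[of _ n n _ m _ m]; use X Y in
        \<open>auto intro!: arg_cong2[of _ _ _ _ "\<lambda>P Q. four_block_mat P X Q (1\<^sub>m m)"]\<close>)
  hence "det ?M * det ?R = det (d \<cdot>\<^sub>m 1\<^sub>m n - X * Y)"
    using X Y M XY det_four_block_mat_lower_left_zero[of "d \<cdot>\<^sub>m 1\<^sub>m n - X * Y" n X m _ "1\<^sub>m m"]
    by (subst det_mult[symmetric, of _ "n + m"]) auto
  moreover have "det ?R = 1"
    using Y by (subst det_four_block_mat_upper_right_zero[of _ n _ m]) auto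
  ultimately have right: "det ?M = det (d \<cdot>\<^sub>m 1\<^sub>m n - X * Y)" by simp
  have "?L * ?M = four_block_mat (d \<cdot>\<^sub>m 1\<^sub>m n) X (0\<^sub>m m n) (d \<cdot>\<^sub>m 1\<^sub>m m - Y * X)"
    by (subst mult_four_block_mat[of _ n n _ m _ m]; use X Y in auto)
  hence "det ?L * det ?M = d ^ n * det (d \<cdot>\<^sub>m 1\<^sub>m m - Y * X)"
    using X Y M YX det_four_block_mat_lower_left_zero[of "d \<cdot>\<^sub>m 1\<^sub>m n" n X m _ "d \<cdot>\<^sub>m 1\<^sub>m m - Y * X"]
    by (subst det_mult[symmetric, of _ "n + m"]) auto
  moreover have "det ?L = d ^ m"
    using Y by (subst det_four_block_mat_upper_right_zero[of _ n _ m]) auto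
  ultimately show ?thesis using right by simp
qed

lemma char_poly_mult_swap:
  fixes X Y :: "'a :: idom mat"
  assumes X: "X \<in> carrier_mat n m" and Y: "Y \<in> carrier_mat m n"
  shows "[:0, 1:] ^ m * char_poly (X * Y) = [:0, 1:] ^ n * char_poly (Y * X)"
proof -
  interpret const: semiring_hom "\<lambda>a :: 'a. [:a:]"
    by unfold_locales auto
  let ?c = "map_mat (\<lambda>a :: 'a. [:a:])"
  have cp: "char_poly (P * Q) = det ([:0, 1:] \<cdot>\<^sub>m 1\<^sub>m r - ?c P * ?c Q)"
    if "P \<in> carrier_mat r t" "Q \<in> carrier_mat t r" for P Q :: "'a mat" and r t
  proof -
    have "?c P * ?c Q = ?c (P * Q)"
      using that by (rule const.mat_hom_mult[symmetric])
    thus ?thesis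
      using that unfolding char_poly_defs by (auto intro!: arg_cong[of _ _ det])
  qed
  show ?thesis
    unfolding cp[OF X Y] cp[OF Y X]
    by (rule det_scalar_minus_mult_swap) (use X Y in auto)
qed

text \<open>
  The matrix \<open>s (J - I)\<close> is a translate of the rank-one matrix \<open>s J\<close>, the product of a column
  and a row. Taking the determinant swap with \<open>d = x + s\<close> in place of \<open>x\<close> absorbs the
  translation and leaves a determinant of size one.
\<close>

lemma char_poly_constant_off_diagonal:
  fixes s :: "'a :: idom"
  assumes "n > 0"
  shows "char_poly (mat n n (\<lambda>(i, j). if i = j then 0 else s))
    = [:s, 1:] ^ (n - 1) * [:- (of_nat (n - 1) * s), 1:]"
proof -
  let ?J = "mat n n (\<lambda>(i, j). if i = j then 0 else s)"
  let ?X = "mat n 1 (\<lambda>_. [:s:])" and ?Y = "mat 1 n (\<lambda>_. 1 :: 'a poly)"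
  have shift: "char_poly ?J = det ([:s, 1:] \<cdot>\<^sub>m 1\<^sub>m n - ?X * ?Y)"
    unfolding char_poly_defs
    by (intro arg_cong[of _ _ det] eq_matI) (auto simp: scalar_prod_def)
  have "det ([:s, 1:] \<cdot>\<^sub>m 1\<^sub>m 1 - ?Y * ?X) = [:s, 1:] - of_nat n * [:s:]"
    by (subst det_single) (auto simp: scalar_prod_def)
  also have "\<dots> = [:- (of_nat (n - 1) * s), 1:]"
    using assms by (cases n) (auto simp: of_nat_poly algebra_simps)
  finally have one: "det ([:s, 1:] \<cdot>\<^sub>m 1\<^sub>m 1 - ?Y * ?X) = [:- (of_nat (n - 1) * s), 1:]" .
  have "[:s, 1:] ^ 1 * char_poly ?J = [:s, 1:] ^ n * [:- (of_nat (n - 1) * s), 1:]"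
    unfolding shift one[symmetric] by (rule det_scalar_minus_mult_swap) auto
  also have "[:s, 1:] ^ n = [:s, 1:] ^ 1 * [:s, 1:] ^ (n - 1)"
    using assms by (simp flip: power_Suc)
  finally show ?thesis by (simp only: mult.assoc mult_cancel_left) simp
qed

section \<open>Counting subsets and points\<close>

lemma card_subsets_containing:
  assumes "finite S" "p \<in> S" "k > 0"
  shows "card {E. E \<subseteq> S \<and> card E = k \<and> p \<in> E} = (card S - 1) choose (k - 1)"
proof -
  have "card {E. E \<subseteq> S \<and> card E = k \<and> p \<in> E}
    = card {E. E \<subseteq> S - {p} \<and> card E = k - 1}"
  proof (rule bij_betw_same_card[of "\<lambda>E. E - {p}"], rule bij_betw_byWitness[where f' = "insert p"])
    show "(\<lambda>E. E - {p}) ` {E. E \<subseteq> S \<and> card E = k \<and> p \<in> E}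
      \<subseteq> {E. E \<subseteq> S - {p} \<and> card E = k - 1}"
      using assms by auto
    show "insert p ` {E. E \<subseteq> S - {p} \<and> card E = k - 1}
      \<subseteq> {E. E \<subseteq> S \<and> card E = k \<and> p \<in> E}"
    proof clarify
      fix E assume E: "E \<subseteq> S - {p}" "card E = k - 1"
      hence "finite E" "p \<notin> E" using assms(1) finite_subset by blast+
      thus "insert p E \<subseteq> S \<and> card (insert p E) = k \<and> p \<in> insert p E"
        using E assms by auto
    qed
  qed auto
  thus ?thesis using n_subsets[of "S - {p}" "k - 1"] assms by simp
qed

text \<open>Matrix indices start at \<open>0\<close>, so the index \<open>p\<close> stands for the point \<open>Suc p\<close>.\<close>

lemma sum_over_points:
  fixes e :: nat
  assumes "F \<subseteq> {1..e}"
  shows "(\<Sum>p = 0..<e. if Suc p \<in> F then 1 else 0 :: real) = card F"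
proof -
  have "(\<Sum>p = 0..<e. if Suc p \<in> F then 1 else 0 :: real) = (\<Sum>q = 1..e. if q \<in> F then 1 else 0)"
    using sum.shift_bounds_Suc_ivl[of "\<lambda>q. if q \<in> F then 1 else 0 :: real" 0 e]
    by (simp add: atLeastLessThanSuc_atLeastAtMost)
  also have "\<dots> = card ({1..e} \<inter> F)" by (simp add: sum.If_cases)
  also have "{1..e} \<inter> F = F" using assms by auto
  finally show ?thesis .
qed

section \<open>Factorization through the point set\<close>

context
  fixes e k :: nat and \<phi> :: "nat \<Rightarrow> nat set"
  assumes k: "k \<in> {1..e - 1}" and enum: "k_subsets_enum e k \<phi>"
begin

abbreviation (input) "incidence \<equiv> mat (e choose k) e (\<lambda>(i, p). if Suc p \<in> \<phi> i then 1 else 0 :: real)"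
abbreviation (input) "co_incidence \<equiv> mat e (e choose k) (\<lambda>(p, i). if Suc p \<in> \<phi> i then 0 else 1 :: real)"

lemma enum_subset:
  assumes "i < e choose k"
  shows "\<phi> i \<subseteq> {1..e}" "card (\<phi> i) = k" "finite (\<phi> i)"
proof -
  show sub: "\<phi> i \<subseteq> {1..e}" and "card (\<phi> i) = k"
    using enum assms unfolding k_subsets_enum_def k_subsets_def bij_betw_def by auto
  show "finite (\<phi> i)" using sub by (rule finite_subset) simp
qed

lemma sum_over_enum:
  "(\<Sum>i = 0..<e choose k. if P (\<phi> i) then 1 else 0 :: real)
    = card {E. E \<subseteq> {1..e} \<and> card E = k \<and> P E}"
proof -
  have bij: "bij_betw \<phi> {0..<e choose k} {E. E \<subseteq> {1..e} \<and> card E = k}"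
    using enum unfolding k_subsets_enum_def k_subsets_def .
  have "(\<Sum>i = 0..<e choose k. if P (\<phi> i) then 1 else 0 :: real)
    = (\<Sum>E | E \<subseteq> {1..e} \<and> card E = k. if P E then 1 else 0)"
    by (rule sum.reindex_bij_betw[OF bij])
  also have "\<dots> = card {E \<in> {E. E \<subseteq> {1..e} \<and> card E = k}. P E}"
    using bij_betw_finite[OF bij] by (subst sum.inter_filter[symmetric]) auto
  finally show ?thesis by (simp add: conj_assoc)
qed

text \<open>
  Row \<open>i\<close> of the first factor selects the points of \<open>\<phi> i\<close>, column \<open>j\<close> of the second those
  outside \<open>\<phi> j\<close>. Their scalar product is the size of the difference, which is the entry of the
  matrix because \<open>\<phi> i\<close> has exactly \<open>k\<close> elements.
\<close>

lemma A_mat_factorization: "A_mat e k \<phi> = incidence * co_incidence"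
proof (rule eq_matI)
  fix i j assume "i < dim_row (incidence * co_incidence)" "j < dim_col (incidence * co_incidence)"
  hence i: "i < e choose k" and j: "j < e choose k" by auto
  have "(incidence * co_incidence) $$ (i, j)
    = (\<Sum>p = 0..<e. if Suc p \<in> \<phi> i - \<phi> j then 1 else 0)"
    using i j by (auto simp: scalar_prod_def intro!: sum.cong)
  also have "\<dots> = card (\<phi> i - \<phi> j)"
    using enum_subset[OF i] by (intro sum_over_points) auto
  also have "\<dots> = real k - real (card (\<phi> i \<inter> \<phi> j))"
    using enum_subset[OF i] card_Diff_subset_Int[of "\<phi> i" "\<phi> j"] card_mono[of "\<phi> i" "\<phi> i \<inter> \<phi> j"]
    by (simp add: of_nat_diff)
  finally show "A_mat e k \<phi> $$ (i, j) = (incidence * co_incidence) $$ (i, j)"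
    using i j by (simp add: A_mat_def)
qed (simp_all add: A_mat_def)

text \<open>
  A subset that avoids \<open>p\<close> and contains \<open>q \<noteq> p\<close> amounts to a choice of \<open>k - 1\<close> further elements
  among the other \<open>e - 2\<close> points; the count does not depend on the pair.
\<close>

lemma co_incidence_mult_incidence:
  "co_incidence * incidence
    = mat e e (\<lambda>(p, q). if p = q then 0 else real ((e - 2) choose (k - 1)))"
proof (rule eq_matI, goal_cases)
  case (1 p q)
  hence p: "p < e" and q: "q < e" by auto
  have "(co_incidence * incidence) $$ (p, q)
    = (\<Sum>i = 0..<e choose k. if Suc p \<notin> \<phi> i \<and> Suc q \<in> \<phi> i then 1 else 0)"
    using p q by (auto simp: scalar_prod_def intro!: sum.cong)
  also have "\<dots> = card {E. E \<subseteq> {1..e} \<and> card E = k \<and> Suc p \<notin> E \<and> Suc q \<in> E}"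
    by (rule sum_over_enum)
  also have "{E. E \<subseteq> {1..e} \<and> card E = k \<and> Suc p \<notin> E \<and> Suc q \<in> E}
    = {E. E \<subseteq> {1..e} - {Suc p} \<and> card E = k \<and> Suc q \<in> E}" by auto
  also have "card \<dots> = (if p = q then 0 else (e - 2) choose (k - 1))"
  proof (cases "p = q")
    case True
    hence "{E. E \<subseteq> {1..e} - {Suc p} \<and> card E = k \<and> Suc q \<in> E} = {}" by auto
    thus ?thesis using True by simp
  next
    case False
    thus ?thesis
      using card_subsets_containing[of "{1..e} - {Suc p}" "Suc q" k] p q k
      by (simp add: numeral_2_eq_2)
  qed
  finally show ?case using p q by simp
qed simp_all

lemma co_incidence_ones:
  "co_incidence *\<^sub>v vec (e choose k) (\<lambda>_. 1) = real ((e - 1) choose k) \<cdot>\<^sub>v vec e (\<lambda>_. 1)"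
proof (rule eq_vecI, goal_cases)
  case (1 p)
  hence p: "p < e" by simp
  have "(co_incidence *\<^sub>v vec (e choose k) (\<lambda>_. 1)) $ p
    = (\<Sum>i = 0..<e choose k. if Suc p \<notin> \<phi> i then 1 else 0)"
    using p by (auto simp: scalar_prod_def intro!: sum.cong)
  also have "\<dots> = card {E. E \<subseteq> {1..e} \<and> card E = k \<and> Suc p \<notin> E}"
    by (rule sum_over_enum)
  also have "{E. E \<subseteq> {1..e} \<and> card E = k \<and> Suc p \<notin> E} = {E. E \<subseteq> {1..e} - {Suc p} \<and> card E = k}"
    by auto
  also have "card \<dots> = (e - 1) choose k"
    using n_subsets[of "{1..e} - {Suc p}" k] p by simp
  finally show ?case using p by simp
qed simp

lemma incidence_ones: "incidence *\<^sub>v vec e (\<lambda>_. 1) = real k \<cdot>\<^sub>v vec (e choose k) (\<lambda>_. 1)"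
proof (rule eq_vecI, goal_cases)
  case (1 i)
  hence i: "i < e choose k" by simp
  thus ?case
    using sum_over_points[OF enum_subset(1)[OF i]] enum_subset(2)[OF i]
    by (simp add: scalar_prod_def)
qed simp

lemma A_mat_ones:
  "A_mat e k \<phi> *\<^sub>v vec (e choose k) (\<lambda>_. 1)
    = (real k * real ((e - 1) choose k)) \<cdot>\<^sub>v vec (e choose k) (\<lambda>_. 1)"
proof -
  have "A_mat e k \<phi> *\<^sub>v vec (e choose k) (\<lambda>_. 1)
    = incidence *\<^sub>v (co_incidence *\<^sub>v vec (e choose k) (\<lambda>_. 1))"
    unfolding A_mat_factorization by (rule assoc_mult_mat_vec) auto
  also have "\<dots> = real ((e - 1) choose k) \<cdot>\<^sub>v (incidence *\<^sub>v vec e (\<lambda>_. 1))"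
    unfolding co_incidence_ones by (rule mult_mat_vec) auto
  finally show ?thesis
    unfolding incidence_ones by (simp add: smult_smult_assoc mult.commute)
qed

lemma char_poly_A_mat:
  "[:0, 1:] ^ e * char_poly (A_mat e k \<phi>)
    = [:0, 1:] ^ (e choose k) * ([:real ((e - 2) choose (k - 1)), 1:] ^ (e - 1)
        * [:- (real k * real ((e - 1) choose k)), 1:])"
proof -
  \<comment> \<open>The simple root \<open>(e - 1) s\<close> of the small matrix, in the form \<open>k binomial(e - 1, k)\<close>.\<close>
  have "k * ((e - 1) choose k) = (e - 1) * ((e - 2) choose (k - 1))"
    using times_binomial_minus1_eq[of k "e - 1"] k by (simp add: numeral_2_eq_2)
  hence a: "real k * real ((e - 1) choose k) = real (e - 1) * real ((e - 2) choose (k - 1))"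
    unfolding of_nat_mult[symmetric] by (rule arg_cong)
  have "[:0, 1:] ^ e * char_poly (A_mat e k \<phi>)
    = [:0, 1:] ^ (e choose k) * char_poly (co_incidence * incidence)"
    unfolding A_mat_factorization by (rule char_poly_mult_swap) auto
  thus ?thesis
    unfolding co_incidence_mult_incidence a
    using k by (subst (asm) char_poly_constant_off_diagonal) auto
qed

end

section \<open>The spectrum\<close>

theorem lemma3p24:
  fixes e k :: nat and \<phi> :: "nat \<Rightarrow> nat set"
  assumes "e \<ge> 2" and "k \<in> {1..e - 1}" and "k_subsets_enum e k \<phi>"
  defines "A \<equiv> A_mat e k \<phi>"
    and "a \<equiv> real k * real ((e - 1) choose k)"
    and "b \<equiv> - real ((e - 2) choose (k - 1))"
  shows "{x. eigenvalue A x} = {x \<in> {a, 0, b}. order x (char_poly A) \<noteq> 0}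
    \<and> order a (char_poly A) = 1
    \<and> int (order 0 (char_poly A)) = int (e choose k) - int e
    \<and> order b (char_poly A) = e - 1
    \<and> eigenvector A (vec (e choose k) (\<lambda>_. 1)) a"
proof -
  let ?\<chi> = "char_poly A" and ?N = "e choose k"
  have A: "A \<in> carrier_mat ?N ?N" by (simp add: A_def A_mat_def)
  have a: "a > 0" and b: "b < 0" using assms(1,2) by (auto simp: a_def b_def)
  have \<chi>: "[:0, 1:] ^ e * ?\<chi> = [:0, 1:] ^ ?N * ([:- b, 1:] ^ (e - 1) * [:- a, 1:])"
    using char_poly_A_mat[OF assms(2,3)] by (simp add: A_def a_def b_def)
  have nz: "?\<chi> \<noteq> 0" using degree_monic_char_poly[OF A] by auto
  have order_power: "order x ([:- c, 1:] ^ n) = (if x = c then n else 0)" for x c :: real and n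
    by (auto simp: order_power_n_n intro!: order_0I)
  \<comment> \<open>The factor \<open>x ^ e\<close> stays on the left, so that the multiplicity of \<open>0\<close> appears in a sum and
      not in a truncated difference of naturals.\<close>
  have ord: "(if x = 0 then e else 0) + order x ?\<chi>
    = (if x = 0 then ?N else 0) + (if x = b then e - 1 else 0) + (if x = a then 1 else 0)" for x
    using arg_cong[OF \<chi>, of "order x"] nz order_power[of x 0 e] order_power[of x 0 ?N]
      order_power[of x b "e - 1"] order_power[of x a 1]
    by (simp add: order_mult del: mult_pCons_left mult_pCons_right)
  have "order a ?\<chi> = 1" "order b ?\<chi> = e - 1" "e + order 0 ?\<chi> = ?N"
    using ord[of a] ord[of b] ord[of 0] a b by auto
  moreover have "eigenvalue A x \<longleftrightarrow> order x ?\<chi> \<noteq> 0" for x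
    using eigenvalue_root_char_poly[OF A] order_root[of ?\<chi> x] nz by simp
  moreover have "x \<in> {a, 0, b}" if "order x ?\<chi> \<noteq> 0" for x
    using ord[of x] that by (auto split: if_splits)
  moreover have "eigenvector A (vec ?N (\<lambda>_. 1)) a"
  proof -
    have "?N > 0" using assms(2) by auto
    hence "vec ?N (\<lambda>_. 1 :: real) $ 0 \<noteq> 0\<^sub>v ?N $ 0"
      by (simp only: index_vec index_zero_vec)
    hence "vec ?N (\<lambda>_. 1 :: real) \<noteq> 0\<^sub>v ?N" by metis
    thus ?thesis
      using A A_mat_ones[OF assms(2,3)] by (simp add: eigenvector_def A_def a_def)
  qed
  ultimately show ?thesis by auto
qed

end
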